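(* For every positive integer $d$, the set $A_w[0,1]^d\setminus A[0,1]^d$ (of all attractors of weak iterated function systems acting on $[0,1]^d$ that are not attractors of any iterated function system acting on $[0,1]^d$) is dense in $K[0,1]^d$.
   Context: Let $[0,1]^d$ carry the Euclidean metric, denoted $\varrho$. $K[0,1]^d$ denotes the space of all nonempty compact subsets of $[0,1]^d$, equipped with the Hausdorff metric $d_H(A,B)=\min\{r\ge 0: A\subseteq \widetilde{B}_r \text{ and } B\subseteq\widetilde{A}_r\}$, where $\widetilde{C}_r=\bigcup_{c\in C}\{x\in[0,1]^d: \varrho(x,c)\le r\}$. A contraction on $[0,1]^d$ is a function $f:[0,1]^d\to[0,1]^d$ for which there is $L\in[0,1)$ with $\varrho(f(x),f(y))\le L\,\varrho(x,y)$ for all $x,y$. A weak contraction on $[0,1]^d$ is a function $f:[0,1]^d\to[0,1]^d$ with $\varrho(f(x),f(y))<\varrho(x,y)$ for all distinct $x,y$. An iterated function system (IFS), respectively weak iterated function system (wIFS), acting on $[0,1]^d$ is a finite nonempty collection of contractions, respectively weak contractions, on $[0,1]^d$. An attractor of an IFS or wIFS $\{s_1,\dots,s_k\}$ is a set $A\in K[0,1]^d$ satisfying $A=\bigcup_{i=1}^k s_i(A)$. $A[0,1]^d$ and $A_w[0,1]^d$ denote the sets of all attractors of IFSs, respectively of wIFSs, acting on $[0,1]^d$, regarded as subsets of $K[0,1]^d$. *)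

theory Defs
  imports "HOL-Analysis.Analysis"
begin

text \<open>
  The dimension is the cardinality of the index type \<open>'n\<close>, which is finite and nonempty;
  \<open>dist\<close> on \<open>real ^ 'n\<close> is the Euclidean metric, and \<open>1\<close> below is the all-ones vector.
\<close>

definition cube :: "(real ^ 'n) set"
  where "cube = cbox 0 1"

definition compacts :: "(real ^ 'n) set set"
  where "compacts = {A. A \<subseteq> cube \<and> compact A \<and> A \<noteq> {}}"

definition nbhd :: "(real ^ 'n) set \<Rightarrow> real \<Rightarrow> (real ^ 'n) set"
  where "nbhd C r = (\<Union>c\<in>C. {x \<in> cube. dist x c \<le> r})"

text \<open>
  The minimum is attained on nonempty compact sets, see \<open>hausdorff_dist_attained\<close>. The value \<open>0\<close>
  off \<open>compacts\<close> is junk, needed only because the locale \<open>Metric_space\<close> demands nonnegativity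
  and symmetry of the distance on the whole type.
\<close>

definition hausdorff_dist :: "(real ^ 'n) set \<Rightarrow> (real ^ 'n) set \<Rightarrow> real"
  where "hausdorff_dist A B =
    (if A \<in> compacts \<and> B \<in> compacts
     then (LEAST r. 0 \<le> r \<and> A \<subseteq> nbhd B r \<and> B \<subseteq> nbhd A r)
     else 0)"

text \<open>
  A map of the cube into itself is represented by a total function, of which only the restriction
  to the cube matters. The predicate \<open>lipschitz_on\<close> includes nonnegativity of the constant.
\<close>

definition contraction :: "(real ^ 'n \<Rightarrow> real ^ 'n) \<Rightarrow> bool"
  where "contraction f \<longleftrightarrow> f \<in> cube \<rightarrow> cube \<and> (\<exists>L<1. L-lipschitz_on cube f)"

definition weak_contraction :: "(real ^ 'n \<Rightarrow> real ^ 'n) \<Rightarrow> bool"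
  where "weak_contraction f \<longleftrightarrow> f \<in> cube \<rightarrow> cube \<and>
    (\<forall>x\<in>cube. \<forall>y\<in>cube. x \<noteq> y \<longrightarrow> dist (f x) (f y) < dist x y)"

definition IFS :: "(real ^ 'n \<Rightarrow> real ^ 'n) set \<Rightarrow> bool"
  where "IFS F \<longleftrightarrow> finite F \<and> F \<noteq> {} \<and> (\<forall>f\<in>F. contraction f)"

definition wIFS :: "(real ^ 'n \<Rightarrow> real ^ 'n) set \<Rightarrow> bool"
  where "wIFS F \<longleftrightarrow> finite F \<and> F \<noteq> {} \<and> (\<forall>f\<in>F. weak_contraction f)"

definition attractor :: "(real ^ 'n \<Rightarrow> real ^ 'n) set \<Rightarrow> (real ^ 'n) set \<Rightarrow> bool"
  where "attractor F A \<longleftrightarrow> A \<in> compacts \<and> A = (\<Union>f\<in>F. f ` A)"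

definition IFS_attractors :: "(real ^ 'n) set set"
  where "IFS_attractors = {A. \<exists>F. IFS F \<and> attractor F A}"

definition wIFS_attractors :: "(real ^ 'n) set set"
  where "wIFS_attractors = {A. \<exists>F. wIFS F \<and> attractor F A}"

lemma subset_nbhd_iff:
  assumes "A \<subseteq> cube"
  shows "A \<subseteq> nbhd B r \<longleftrightarrow> (\<forall>a\<in>A. \<exists>b\<in>B. dist a b \<le> r)"
  using assms unfolding nbhd_def by blast

lemma subset_nbhd_infdist:
  assumes "A \<in> compacts" "B \<in> compacts"
  shows "A \<subseteq> nbhd B r \<longleftrightarrow> (\<forall>a\<in>A. infdist a B \<le> r)"
proof -
  have B: "closed B" "B \<noteq> {}" and A: "A \<subseteq> cube"
    using assms by (auto simp: compacts_def compact_imp_closed)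
  have "(\<exists>b\<in>B. dist a b \<le> r) \<longleftrightarrow> infdist a B \<le> r" for a
    using infdist_attains_inf[OF B, of a] infdist_le2[of _ B a r] by metis
  then show ?thesis
    by (simp add: subset_nbhd_iff[OF A])
qed

lemma hausdorff_dist_attained:
  assumes "A \<in> compacts" "B \<in> compacts"
  defines "S \<equiv> {r. 0 \<le> r \<and> A \<subseteq> nbhd B r \<and> B \<subseteq> nbhd A r}"
  shows "hausdorff_dist A B \<in> S" and "\<And>r. r \<in> S \<Longrightarrow> hausdorff_dist A B \<le> r"
proof -
  have S: "S = {r. 0 \<le> r \<and> (\<forall>a\<in>A. infdist a B \<le> r) \<and> (\<forall>b\<in>B. infdist b A \<le> r)}"
    using assms by (simp add: S_def subset_nbhd_infdist)
  have bd: "bounded A" "bounded B" and ne: "A \<noteq> {}" "B \<noteq> {}"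
    using assms by (auto simp: compacts_def compact_imp_bounded)
  have "diameter (A \<union> B) \<in> S"
  proof -
    have U: "bounded (A \<union> B)"
      using bd by simp
    have d: "dist x y \<le> diameter (A \<union> B)" if "x \<in> A \<union> B" "y \<in> A \<union> B" for x y
      using diameter_bounded_bound[OF U that] .
    have "infdist a B \<le> diameter (A \<union> B)" if "a \<in> A" for a
      using ne(2) d that by (metis UnCI ex_in_conv infdist_le2)
    moreover have "infdist b A \<le> diameter (A \<union> B)" if "b \<in> B" for b
      using ne(1) d that by (metis UnCI ex_in_conv infdist_le2)
    ultimately show ?thesis
      using diameter_ge_0[OF U] by (simp add: S)
  qed
  then have nonempty: "S \<noteq> {}"
    by blast
  have bdd: "bdd_below S"
    unfolding S by (rule bdd_belowI[of _ 0]) simp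
  have InfS: "Inf S \<in> S"
    using nonempty unfolding S by (auto intro!: cInf_greatest)
  have lower: "Inf S \<le> r" if "r \<in> S" for r
    using that bdd by (rule cInf_lower)
  have eq: "hausdorff_dist A B = Inf S"
    unfolding hausdorff_dist_def using assms(1,2) InfS lower
    by (auto simp: S_def intro!: Least_equality)
  show "hausdorff_dist A B \<in> S"
    using InfS eq by simp
  show "hausdorff_dist A B \<le> r" if "r \<in> S" for r
    using lower[OF that] eq by simp
qed

lemma hausdorff_dist_le_iff:
  assumes "A \<in> compacts" "B \<in> compacts"
  shows "hausdorff_dist A B \<le> r \<longleftrightarrow>
    (\<forall>a\<in>A. \<exists>b\<in>B. dist a b \<le> r) \<and> (\<forall>b\<in>B. \<exists>a\<in>A. dist b a \<le> r)"
proof -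
  have sub: "A \<subseteq> cube" "B \<subseteq> cube" and ne: "A \<noteq> {}"
    using assms by (auto simp: compacts_def)
  note att = hausdorff_dist_attained[OF assms, simplified subset_nbhd_iff[OF sub(1)]
      subset_nbhd_iff[OF sub(2)]]
  show ?thesis
  proof
    assume "hausdorff_dist A B \<le> r"
    then show "(\<forall>a\<in>A. \<exists>b\<in>B. dist a b \<le> r) \<and> (\<forall>b\<in>B. \<exists>a\<in>A. dist b a \<le> r)"
      using att(1) by (smt (verit) mem_Collect_eq)
  next
    assume *: "(\<forall>a\<in>A. \<exists>b\<in>B. dist a b \<le> r) \<and> (\<forall>b\<in>B. \<exists>a\<in>A. dist b a \<le> r)"
    then have "0 \<le> r"
      using ne by (meson ex_in_conv order_trans zero_le_dist)
    with * show "hausdorff_dist A B \<le> r"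
      using att(2) by simp
  qed
qed

lemma Metric_space_hausdorff_dist: "Metric_space compacts hausdorff_dist"
proof
  fix A B :: "(real ^ 'n) set"
  show "0 \<le> hausdorff_dist A B"
  proof (cases "A \<in> compacts \<and> B \<in> compacts")
    case True
    then show ?thesis
      using hausdorff_dist_attained(1)[of A B] by simp
  qed (auto simp: hausdorff_dist_def)
  show "hausdorff_dist A B = hausdorff_dist B A"
    unfolding hausdorff_dist_def by (simp add: conj_commute conj_left_commute)
next
  fix A B :: "(real ^ 'n) set"
  assume AB: "A \<in> compacts" "B \<in> compacts"
  have nonneg: "0 \<le> hausdorff_dist A B"
    using hausdorff_dist_attained(1)[OF AB] by simp
  have "hausdorff_dist A B \<le> 0 \<longleftrightarrow> A = B"
    unfolding hausdorff_dist_le_iff[OF AB] by auto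
  with nonneg show "hausdorff_dist A B = 0 \<longleftrightarrow> A = B"
    by linarith
next
  fix A B C :: "(real ^ 'n) set"
  assume *: "A \<in> compacts" "B \<in> compacts" "C \<in> compacts"
  note AB = hausdorff_dist_le_iff[OF *(1,2), THEN iffD1, OF order_refl]
  note BC = hausdorff_dist_le_iff[OF *(2,3), THEN iffD1, OF order_refl]
  show "hausdorff_dist A C \<le> hausdorff_dist A B + hausdorff_dist B C"
    unfolding hausdorff_dist_le_iff[OF *(1,3)]
  proof (intro conjI ballI)
    fix a assume "a \<in> A"
    with AB BC obtain b c where "b \<in> B" "c \<in> C"
      "dist a b \<le> hausdorff_dist A B" "dist b c \<le> hausdorff_dist B C" by meson
    then show "\<exists>c\<in>C. dist a c \<le> hausdorff_dist A B + hausdorff_dist B C"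
      using dist_triangle[of a c b] by (intro bexI[of _ c]) auto
  next
    fix c assume "c \<in> C"
    with AB BC obtain a b where "b \<in> B" "a \<in> A"
      "dist b a \<le> hausdorff_dist A B" "dist c b \<le> hausdorff_dist B C" by meson
    then show "\<exists>a\<in>A. dist c a \<le> hausdorff_dist A B + hausdorff_dist B C"
      using dist_triangle[of c a b] by (intro bexI[of _ a]) auto
  qed
qed

end

theory Submission
  imports Defs
begin

text \<open>
  The map \<open>h t = t - exp (- 1 / t)\<close> is a weak contraction of \<open>[0, \<infinity>)\<close> so close to the identity
  near \<open>0\<close> that an orbit \<open>a n\<close> of \<open>h\<close> has at least \<open>t * exp (1 / (2 * t))\<close> terms above \<open>t\<close>.
  Approximate a compact set by a finite set \<open>F\<close>, choose \<open>p \<in> F\<close> with maximal \<open>i\<close>-th coordinate, and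
  attach the points \<open>p + a n *\<^sub>R e\<close>, with \<open>e\<close> the \<open>i\<close>-th unit vector. Applying \<open>h\<close> along the spike
  shifts its points and, by maximality, collapses \<open>F\<close> to \<open>p\<close>; with finitely many constant maps
  this gives a weak IFS. If an IFS with Lipschitz constants at most \<open>L < 1\<close> had the same attractor,
  its maps moving \<open>p\<close> would have finite image on it, and those fixing \<open>p\<close> would show that the
  number \<open>N t\<close> of points at distance more than \<open>t\<close> from \<open>p\<close> satisfies \<open>N (L * t) \<le> C + k * N t\<close>.
  Then \<open>N\<close> grows only polynomially in \<open>1 / t\<close>, a contradiction.
\<close>

section \<open>A weak contraction of the line that is flat against the identity at 0\<close>

text \<open>The value \<open>0\<close> on the negative half-line is deliberate: arguments will be
  differences of coordinates, and it sends everything behind the base point of the spike to that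
  point.\<close>

definition flat_step :: "real \<Rightarrow> real"
  where "flat_step t = (if t \<le> 0 then 0 else t - exp (- (1 / t)))"

lemma exp_neg_inverse_less:
  fixes t :: real
  assumes "0 < t"
  shows "exp (- (1 / t)) < t"
proof -
  have "1 / t < exp (1 / t)"
    using exp_ge_add_one_self[of "1 / t"] by linarith
  then show ?thesis
    using assms by (simp add: exp_minus field_simps)
qed

text \<open>Squaring \<open>u < exp (u / 2)\<close>, which follows from the quadratic Taylor bound.
  With \<open>u = 1 / z\<close> it says that the derivative of \<open>flat_step\<close> at
  \<open>z\<close> is positive.\<close>

lemma square_less_exp:
  fixes u :: real
  assumes "0 < u"
  shows "u\<^sup>2 < exp u"
proof -
  have "0 < 1 - u / 2 + u\<^sup>2 / 8"
    using zero_le_power2[of "u - 2"] by (simp add: power2_eq_square algebra_simps)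
  then have "u < 1 + u / 2 + (u / 2)\<^sup>2 / 2"
    by (simp add: power2_eq_square algebra_simps)
  also have "\<dots> \<le> exp (u / 2)"
    using assms by (intro exp_lower_Taylor_quadratic) simp
  finally have "u\<^sup>2 < (exp (u / 2))\<^sup>2"
    using assms by (intro power_strict_mono) auto
  then show ?thesis
    by (simp add: power2_eq_square flip: exp_add)
qed

lemma flat_step_less: "0 < t \<Longrightarrow> flat_step t < t"
  by (simp add: flat_step_def)

lemma flat_step_pos: "0 < t \<Longrightarrow> 0 < flat_step t"
  using exp_neg_inverse_less[of t] by (simp add: flat_step_def)

text \<open>By the mean value theorem, since the derivative
  \<open>1 - (1 / z)\<^sup>2 * exp (- (1 / z))\<close> lies strictly between 0 and 1.\<close>

lemma flat_step_strict_mono_contract: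
  assumes "0 < s" "s < t"
  shows "flat_step s < flat_step t \<and> flat_step t - flat_step s < t - s"
proof -
  have "\<exists>z. s < z \<and> z < t \<and> (t - exp (- (1 / t))) - (s - exp (- (1 / s)))
      = (t - s) * (1 - (1 / z)\<^sup>2 * exp (- (1 / z)))"
    using assms
    by (intro MVT2[where f = "\<lambda>x. x - exp (- (1 / x))"])
       (auto intro!: derivative_eq_intros simp: power2_eq_square)
  then obtain z where z: "s < z" "flat_step t - flat_step s
      = (t - s) * (1 - (1 / z)\<^sup>2 * exp (- (1 / z)))"
    using assms by (auto simp: flat_step_def)
  have "(1 / z)\<^sup>2 * exp (- (1 / z)) < 1" "0 < (1 / z)\<^sup>2 * exp (- (1 / z))"
    using square_less_exp[of "1 / z"] z(1) assms by (auto simp: exp_minus field_simps)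
  moreover have "(t - s) * (1 - w) < t - s" "0 < (t - s) * (1 - w)" if "w < 1" "0 < w" for w
    using that assms mult_pos_pos[of "t - s" w] by (auto simp: right_diff_distrib)
  ultimately show ?thesis
    using z(2) by (smt (verit))
qed

lemma flat_step_mono: "0 < s \<Longrightarrow> s \<le> t \<Longrightarrow> flat_step s \<le> flat_step t"
  using flat_step_strict_mono_contract[of s t] by (cases "s = t") auto

lemma flat_step_weak_contraction:
  assumes "s \<noteq> t"
  shows "\<bar>flat_step s - flat_step t\<bar> < \<bar>s - t\<bar>"
proof -
  have *: "\<bar>flat_step s - flat_step t\<bar> < \<bar>s - t\<bar>" if "s < t" for s t
  proof (cases "0 < s")
    case True
    then show ?thesis
      using flat_step_strict_mono_contract[of s t] that by linarith
  next
    case False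
    then have "flat_step s = 0"
      by (simp add: flat_step_def)
    moreover have "0 \<le> flat_step t" "flat_step t \<le> max 0 t" "0 < t \<Longrightarrow> flat_step t < t"
      using flat_step_pos[of t] flat_step_less[of t] by (auto simp: flat_step_def)
    ultimately show ?thesis
      using False that by linarith
  qed
  show ?thesis
    using assms *[of s t] *[of t s] by (cases "s < t") (auto simp: abs_minus_commute)
qed

section \<open>Slow convergence of the orbits\<close>

definition flat_orbit :: "real \<Rightarrow> nat \<Rightarrow> real"
  where "flat_orbit \<delta> n = (flat_step ^^ n) \<delta>"

lemma flat_orbit_0 [simp]: "flat_orbit \<delta> 0 = \<delta>"
  by (simp add: flat_orbit_def)

lemma flat_orbit_Suc: "flat_orbit \<delta> (Suc n) = flat_step (flat_orbit \<delta> n)"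
  by (simp add: flat_orbit_def)

context
  fixes \<delta> :: real
  assumes \<delta>: "0 < \<delta>"
begin

lemma flat_orbit_pos: "0 < flat_orbit \<delta> n"
  using \<delta> by (induction n) (auto simp: flat_orbit_Suc flat_step_pos)

lemma strict_antimono_flat_orbit: "m < n \<Longrightarrow> flat_orbit \<delta> n < flat_orbit \<delta> m"
  by (rule lift_Suc_mono_less[of "\<lambda>n. - flat_orbit \<delta> n", simplified])
     (auto simp: flat_orbit_Suc flat_step_less flat_orbit_pos)

lemma inj_flat_orbit: "inj (flat_orbit \<delta>)"
  using strict_antimono_flat_orbit by (metis injI less_irrefl linorder_neqE_nat)

lemma flat_orbit_le: "flat_orbit \<delta> n \<le> \<delta>"
  using strict_antimono_flat_orbit[of 0 n] by (cases n) auto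

text \<open>The orbit decreases to some limit, and a positive limit would be a fixed point of
  \<open>flat_step\<close>, which \<open>exp\<close> being nonzero forbids.\<close>

lemma flat_orbit_tendsto: "flat_orbit \<delta> \<longlonglongrightarrow> 0"
proof -
  have "decseq (flat_orbit \<delta>)"
    by (intro decseq_SucI less_imp_le strict_antimono_flat_orbit) simp
  then obtain l where l: "flat_orbit \<delta> \<longlonglongrightarrow> l"
    using decseq_convergent[of "flat_orbit \<delta>" 0] flat_orbit_pos less_imp_le by metis
  have "l = 0"
  proof (rule ccontr)
    assume "l \<noteq> 0"
    moreover have "0 \<le> l"
      using l by (rule LIMSEQ_le_const) (auto intro: less_imp_le flat_orbit_pos)
    ultimately have "0 < l"
      by simp
    have "(\<lambda>n. flat_orbit \<delta> n - exp (- (1 / flat_orbit \<delta> n))) \<longlonglongrightarrow> l - exp (- (1 / l))"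
      using \<open>l \<noteq> 0\<close> by (intro tendsto_intros l)
    moreover have "flat_orbit \<delta> n - exp (- (1 / flat_orbit \<delta> n)) = flat_orbit \<delta> (Suc n)" for n
      using flat_orbit_pos[of n] by (simp add: flat_orbit_Suc flat_step_def)
    ultimately have "(\<lambda>n. flat_orbit \<delta> (Suc n)) \<longlonglongrightarrow> l - exp (- (1 / l))"
      by simp
    moreover have "(\<lambda>n. flat_orbit \<delta> (Suc n)) \<longlonglongrightarrow> l"
      using l by (rule LIMSEQ_Suc)
    ultimately have "l - exp (- (1 / l)) = l"
      by (rule LIMSEQ_unique)
    then show False
      by simp
  qed
  with l show ?thesis
    by simp
qed

lemma finite_flat_orbit_greater: "0 < t \<Longrightarrow> finite {n. t < flat_orbit \<delta> n}"
proof -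
  assume "0 < t"
  then obtain N where "\<And>n. n \<ge> N \<Longrightarrow> flat_orbit \<delta> n < t"
    using order_tendstoD(2)[OF flat_orbit_tendsto] unfolding eventually_sequentially by blast
  then have "{n. t < flat_orbit \<delta> n} \<subseteq> {..<N}"
    by (smt (verit) lessThan_iff mem_Collect_eq not_le subsetI)
  then show ?thesis
    using finite_subset by blast
qed

text \<open>Below \<open>2 * t\<close> the orbit moves by at most \<open>exp (- 1 / (2 * t))\<close> per step.\<close>

lemma card_flat_orbit_greater:
  assumes "0 < t" "2 * t \<le> \<delta>"
  shows "t * exp (1 / (2 * t)) \<le> card {n. t < flat_orbit \<delta> n}"
proof -
  define g where "g = exp (- (1 / (2 * t)))"
  have slow: "2 * t - n * g \<le> flat_orbit \<delta> n" for n :: nat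
  proof (induction n)
    case 0
    then show ?case
      using assms by simp
  next
    case (Suc n)
    show ?case
    proof (cases "2 * t \<le> flat_orbit \<delta> n")
      \<comment> \<open>From \<open>2 * t\<close> or above, monotonicity keeps the next term at
        least \<open>flat_step (2 * t)\<close>, which is exactly \<open>2 * t - g\<close>.\<close>
      case True
      have "2 * t - Suc n * g \<le> 2 * t - g"
        by (simp add: g_def algebra_simps)
      also have "\<dots> = flat_step (2 * t)"
        using assms by (simp add: flat_step_def g_def)
      also have "\<dots> \<le> flat_orbit \<delta> (Suc n)"
        unfolding flat_orbit_Suc using True assms by (intro flat_step_mono) auto
      finally show ?thesis .
    next
      case False
      then have "exp (- (1 / flat_orbit \<delta> n)) \<le> g"
        using flat_orbit_pos[of n] assms by (simp add: g_def frac_le)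
      then show ?thesis
        using Suc flat_orbit_pos[of n] by (simp add: flat_orbit_Suc flat_step_def algebra_simps)
    qed
  qed
  have fin: "finite {n. t < flat_orbit \<delta> n}"
    using assms by (intro finite_flat_orbit_greater)
  \<comment> \<open>The first index at or below \<open>t\<close>: by \<open>slow\<close>, falling
    from \<open>2 * t\<close> to \<open>t\<close> costs at least \<open>t / g\<close> steps.\<close>
  define M where "M = (LEAST n. flat_orbit \<delta> n \<le> t)"
  have "\<exists>n. flat_orbit \<delta> n \<le> t"
    using fin infinite_UNIV_nat by (metis (mono_tags, lifting) UNIV_eq_I mem_Collect_eq not_le)
  then have M: "flat_orbit \<delta> M \<le> t"
    unfolding M_def by (rule LeastI_ex)
  have "{..<M} \<subseteq> {n. t < flat_orbit \<delta> n}"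
    using not_less_Least unfolding M_def by fastforce
  then have "M \<le> card {n. t < flat_orbit \<delta> n}"
    using card_mono[OF fin, of "{..<M}"] by simp
  moreover have "t \<le> M * g"
    using slow[of M] M by linarith
  then have "t * exp (1 / (2 * t)) \<le> M"
    by (simp add: g_def exp_minus field_simps)
  ultimately show ?thesis
    by linarith
qed

end

section \<open>Exponential against polynomial growth\<close>

text \<open>With \<open>t = L ^ j\<close>, choosing \<open>q\<close> with
  \<open>K * L ^ q < 1\<close> makes \<open>K ^ j\<close> smaller than \<open>1 / t ^ q\<close>,
  whereas \<open>exp (1 / (2 * t))\<close> exceeds a multiple of every power of
  \<open>1 / t\<close>.\<close>

lemma exp_inverse_not_polynomially_bounded:
  fixes D K L \<delta> :: real
  assumes "0 < L" "L < 1" "0 < \<delta>" "0 < K"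
  shows "\<exists>j. 2 * L ^ j \<le> \<delta> \<and> D * K ^ j < L ^ j * exp (1 / (2 * L ^ j))"
proof -
  have L0: "(\<lambda>n. L ^ n) \<longlonglongrightarrow> 0"
    using assms by (intro LIMSEQ_realpow_zero) auto
  then obtain q where q: "L ^ q < 1 / K"
    using order_tendstoD(2)[OF L0, of "1 / K"] assms by (auto simp: eventually_sequentially)
  \<comment> \<open>One power more than \<open>q\<close>, because the factor \<open>t\<close> in
    front of the exponential consumes one.\<close>
  define m where "m = Suc q"
  define c where "c = (1 / (2 * real m)) ^ m"
  have c: "0 < c"
    by (simp add: c_def m_def)
  have "(\<lambda>j. D * (K * L ^ q) ^ j) \<longlonglongrightarrow> D * 0"
    using assms q by (intro tendsto_mult tendsto_const LIMSEQ_realpow_zero) (auto simp: field_simps)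
  then have "\<forall>\<^sub>F j in sequentially. D * (K * L ^ q) ^ j < c"
    using c by (intro order_tendstoD(2)) auto
  moreover have "\<forall>\<^sub>F j in sequentially. L ^ j < \<delta> / 2"
    using order_tendstoD(2)[OF L0, of "\<delta> / 2"] assms by simp
  ultimately have "\<forall>\<^sub>F j in sequentially. D * (K * L ^ q) ^ j < c \<and> L ^ j < \<delta> / 2"
    by (rule eventually_conj)
  then obtain j where j: "D * (K * L ^ q) ^ j < c" "L ^ j < \<delta> / 2"
    by (auto simp: eventually_sequentially)
  define t where "t = L ^ j"
  have t: "0 < t"
    using assms by (simp add: t_def)
  have "D * K ^ j * t ^ q < c"
    using j(1) by (simp add: t_def power_mult_distrib mult.assoc flip: power_mult)
      (simp add: mult.commute)
  then have "D * K ^ j < c / t ^ q"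
    using t by (simp add: field_simps)
  also have "\<dots> = t * (c / t ^ m)"
    using t by (simp add: m_def)
  also have "c / t ^ m = (1 / (2 * t) / m) ^ m"
    unfolding c_def power_divide[symmetric] by (simp add: ac_simps)
  also have "t * (1 / (2 * t) / m) ^ m \<le> t * (1 + 1 / (2 * t) / m) ^ m"
    using t by (intro mult_left_mono power_mono) auto
  also have "\<dots> \<le> t * exp (1 / (2 * t))"
    using t by (intro mult_left_mono exp_ge_one_plus_x_over_n_power_n)
      (auto simp: m_def intro: order_trans[of _ 0])
  finally show ?thesis
    using j(2) by (intro exI[of _ j]) (simp add: t_def)
qed

section \<open>Counting points in attractors of contractions\<close>

text \<open>Points close to \<open>p\<close> are sent close to \<open>f p\<close>, hence away from
  \<open>p\<close>, where \<open>A\<close> has only finitely many points. The remaining points of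
  \<open>A\<close> are finite in number themselves.\<close>

lemma finite_image_of_moved_point:
  fixes A :: "'a::metric_space set"
  assumes fin: "\<And>t. 0 < t \<Longrightarrow> finite {x \<in> A. t < dist x p}"
    and "p \<in> A" "f p \<noteq> p" "f ` A \<subseteq> A" "1-lipschitz_on A f"
  shows "finite (f ` A)"
proof -
  define r where "r = dist (f p) p / 4"
  have r: "0 < r"
    using assms by (simp add: r_def)
  have "f ` A \<subseteq> f ` {x \<in> A. r < dist x p} \<union> {y \<in> A. r < dist y p}"
  proof
    fix y assume "y \<in> f ` A"
    then obtain x where x: "x \<in> A" "y = f x"
      by blast
    have "dist (f x) (f p) \<le> dist x p"
      using lipschitz_onD[OF assms(5)] x assms by simp
    moreover have "4 * r = dist (f p) p"
      by (simp add: r_def)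
    ultimately have "r < dist y p" if "dist x p \<le> r"
      using that dist_triangle[of "f p" p y] x r by (simp add: dist_commute)
    then show "y \<in> f ` {x \<in> A. r < dist x p} \<union> {y \<in> A. r < dist y p}"
      using x assms by force
  qed
  then show ?thesis
    using fin[OF r] by (meson finite_UnI finite_imageI finite_subset)
qed

text \<open>If \<open>f\<close> fixes \<open>p\<close>, a value \<open>f y\<close> farther than
  \<open>L * t\<close> from \<open>p\<close> forces \<open>y\<close> farther than \<open>t\<close>.
  The other maps contribute only the finite set \<open>E\<close>. Iterating the resulting recursion
  from scale 1 gives the bound.\<close>

lemma self_similar_card_bound:
  fixes A :: "'a::metric_space set"
  assumes fin: "\<And>t. 0 < t \<Longrightarrow> finite {x \<in> A. t < dist x p}"
    and "p \<in> A" "finite F" "\<And>f. f \<in> F \<Longrightarrow> \<exists>L<1. L-lipschitz_on A f" "A = (\<Union>f\<in>F. f ` A)"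
  shows "\<exists>L K D :: real. 0 < L \<and> L < 1 \<and> 0 < K \<and>
    (\<forall>j. card {x \<in> A. L ^ j < dist x p} \<le> D * K ^ j)"
proof -
  have "\<exists>L. 0 < L \<and> L < 1 \<and> (\<forall>f\<in>F. L-lipschitz_on A f)"
    using assms(3,4)
  proof (induction F)
    case empty
    then show ?case
      by (auto intro: exI[of _ "1/2"])
  next
    case (insert f F)
    then obtain L M where "0 < L" "L < 1" "\<forall>f\<in>F. L-lipschitz_on A f"
      "M < 1" "M-lipschitz_on A f"
      by (metis insertCI)
    then show ?case
      by (intro exI[of _ "max L M"]) (auto intro: lipschitz_on_le)
  qed
  then obtain L where L: "0 < L" "L < 1" and lip: "\<And>f. f \<in> F \<Longrightarrow> L-lipschitz_on A f"
    by blast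
  define N where "N t = card {x \<in> A. t < dist x p}" for t
  define E where "E = (\<Union>f\<in>{f\<in>F. f p \<noteq> p}. f ` A)"
  have E: "finite E"
    unfolding E_def
  proof (intro finite_UN_I)
    fix f assume f: "f \<in> {f\<in>F. f p \<noteq> p}"
    show "finite (f ` A)"
    proof (rule finite_image_of_moved_point[OF fin \<open>p \<in> A\<close>])
      show "f ` A \<subseteq> A"
        using f assms(5) by blast
      show "1-lipschitz_on A f"
        using f lip[of f] L by (auto intro: lipschitz_on_le)
    qed (use f in auto)
  qed (use assms in auto)
  have rec: "N (L * t) \<le> card E + card F * N t" if "0 < t" for t
  proof -
    let ?B = "{x \<in> A. t < dist x p}"
    have "{x \<in> A. L * t < dist x p} \<subseteq> E \<union> (\<Union>f\<in>F. f ` ?B)"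
    proof
      fix x assume x: "x \<in> {x \<in> A. L * t < dist x p}"
      then obtain f y where f: "f \<in> F" "y \<in> A" "x = f y"
        using assms(5) by blast
      show "x \<in> E \<union> (\<Union>f\<in>F. f ` ?B)"
      proof (cases "f p = p")
        case True
        then have "dist x p \<le> L * dist y p"
          using lipschitz_onD[OF lip[OF f(1)] f(2) \<open>p \<in> A\<close>] f by simp
        then have "L * t < L * dist y p"
          using x by simp
        then show ?thesis
          using f L by auto
      next
        case False
        then show ?thesis
          using f by (auto simp: E_def)
      qed
    qed
    then have "N (L * t) \<le> card (E \<union> (\<Union>f\<in>F. f ` ?B))"
      unfolding N_def using E assms fin[OF that] by (intro card_mono) auto
    also have "\<dots> \<le> card E + card (\<Union>f\<in>F. f ` ?B)"
      by (rule card_Un_le)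
    also have "card (\<Union>f\<in>F. f ` ?B) \<le> (\<Sum>f\<in>F. card (f ` ?B))"
      using assms by (intro card_UN_le)
    also have "\<dots> \<le> card F * N t"
      using sum_bounded_above[OF card_image_le[OF fin[OF that]]] by (simp add: N_def)
    finally show ?thesis
      by simp
  qed
  \<comment> \<open>\<open>N 1\<close> starts the induction. The additive term \<open>card E\<close>
    is at most \<open>D\<close>, so raising the base from \<open>card F\<close> to
    \<open>card F + 1\<close> absorbs it at every step.\<close>
  define D where "D = card E + N 1"
  have "N (L ^ j) \<le> D * (card F + 1) ^ j" for j
  proof (induction j)
    case 0
    then show ?case
      by (simp add: D_def)
  next
    case (Suc j)
    have "N (L ^ Suc j) \<le> card E + card F * N (L ^ j)"
      using rec[of "L ^ j"] L by simp
    also have "\<dots> \<le> D * (card F + 1) ^ j + card F * (D * (card F + 1) ^ j)"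
    proof (intro add_mono mult_left_mono Suc)
      have "card E * 1 \<le> D * (card F + 1) ^ j"
        by (intro mult_mono) (auto simp: D_def)
      then show "card E \<le> D * (card F + 1) ^ j"
        by simp
    qed simp
    also have "\<dots> = D * (card F + 1) ^ Suc j"
      by (simp add: algebra_simps)
    finally show ?case .
  qed
  then have "real (N (L ^ j)) \<le> real D * real (card F + 1) ^ j" for j
    by (metis of_nat_le_iff of_nat_mult of_nat_power)
  then show ?thesis
    using L by (intro exI[of _ L] exI[of _ "real (card F + 1)"] exI[of _ "real D"])
      (simp add: N_def)
qed

section \<open>Finite sets with a spike attached\<close>

text \<open>The limit \<open>p\<close> of the sequence is not added separately; it will belong to
  \<open>F\<close>.\<close>

definition spike :: "(real ^ 'n) set \<Rightarrow> real ^ 'n \<Rightarrow> 'n \<Rightarrow> real \<Rightarrow> (real ^ 'n) set"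
  where "spike F p i \<delta> = F \<union> range (\<lambda>n. p + flat_orbit \<delta> n *\<^sub>R axis i 1)"

context
  fixes F :: "(real ^ 'n) set" and p :: "real ^ 'n" and i :: 'n and \<delta> :: real
  assumes F: "finite F" "F \<subseteq> cube" "p \<in> F" and p_max: "\<And>x. x \<in> F \<Longrightarrow> x $ i \<le> p $ i"
    and \<delta>: "0 < \<delta>" "p $ i + \<delta> \<le> 1"
begin

lemma spike_in_compacts: "spike F p i \<delta> \<in> compacts"
proof -
  have "(\<lambda>n. p + flat_orbit \<delta> n *\<^sub>R axis i 1) \<longlonglongrightarrow> p + 0 *\<^sub>R axis i 1"
    by (intro tendsto_intros flat_orbit_tendsto \<delta>(1))
  then have "compact (insert p (range (\<lambda>n. p + flat_orbit \<delta> n *\<^sub>R axis i 1)))"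
    by (intro compact_sequence_with_limit) simp
  moreover have "spike F p i \<delta> = F \<union> insert p (range (\<lambda>n. p + flat_orbit \<delta> n *\<^sub>R axis i 1))"
    using F(3) by (auto simp: spike_def)
  ultimately have "compact (spike F p i \<delta>)"
    using F(1) by (metis compact_Un finite_imp_compact)
  moreover have "p + flat_orbit \<delta> n *\<^sub>R axis i 1 \<in> cube" for n
  proof -
    have "0 \<le> p $ j \<and> p $ j \<le> 1" for j
      using F by (auto simp: cube_def mem_box_cart)
    moreover have "0 < flat_orbit \<delta> n" "flat_orbit \<delta> n \<le> \<delta>"
      using \<delta>(1) by (auto intro: flat_orbit_pos flat_orbit_le)
    ultimately show ?thesis
      using \<delta>(2) by (auto simp: cube_def mem_box_cart axis_def intro: add_nonneg_nonneg)
  qed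
  ultimately show ?thesis
    using F by (auto simp: compacts_def spike_def)
qed

text \<open>The map \<open>f\<close> projects to the axis through \<open>p\<close> and then applies
  \<open>flat_step\<close>. It collapses \<open>F\<close> to \<open>p\<close> and shifts the spike
  by one index, so its image misses only the first spike point and points of \<open>F\<close>; the
  constant maps with values in \<open>Q\<close> supply these.\<close>

lemma spike_in_wIFS_attractors: "spike F p i \<delta> \<in> wIFS_attractors"
proof -
  define f where "f x = p + flat_step (x $ i - p $ i) *\<^sub>R axis i 1" for x :: "real ^ 'n"
  define Q where "Q = insert (p + \<delta> *\<^sub>R axis i 1) F"
  define W where "W = insert f ((\<lambda>q x. q) ` Q)"
  have Q: "finite Q" "Q \<subseteq> spike F p i \<delta>"
    using F by (auto simp: Q_def spike_def intro!: range_eqI[of _ _ 0])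
  have sub: "spike F p i \<delta> \<subseteq> cube" and p: "p \<in> spike F p i \<delta>"
    using spike_in_compacts F by (auto simp: compacts_def spike_def)
  have "f \<in> cube \<rightarrow> cube"
  proof
    fix x :: "real ^ 'n" assume x: "x \<in> cube"
    have bds: "0 \<le> p $ j \<and> p $ j \<le> 1" "0 \<le> x $ j \<and> x $ j \<le> 1" for j
      using F x by (auto simp: cube_def mem_box_cart)
    have "0 \<le> flat_step t" "flat_step t \<le> max 0 t" for t
      using flat_step_pos[of t] flat_step_less[of t] by (auto simp: flat_step_def)
    from this[of "x $ i - p $ i"] have "0 \<le> f x $ j \<and> f x $ j \<le> 1" for j
      using bds[of j] by (cases "j = i") (auto simp: f_def axis_def)
    then show "f x \<in> cube"
      by (simp add: cube_def mem_box_cart)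
  qed
  moreover have "dist (f x) (f y) < dist x y" if "x \<noteq> y" for x y
  proof (cases "x $ i = y $ i")
    case True
    then show ?thesis
      using that by (simp add: f_def)
  next
    case False
    have "dist (f x) (f y) = \<bar>flat_step (x $ i - p $ i) - flat_step (y $ i - p $ i)\<bar>"
      by (simp add: f_def dist_norm flip: scaleR_diff_left)
    also have "\<dots> < \<bar>x $ i - y $ i\<bar>"
      using flat_step_weak_contraction[of "x $ i - p $ i" "y $ i - p $ i"] False by simp
    also have "\<dots> \<le> dist x y"
      using component_le_norm_cart[of "x - y" i] by (simp add: dist_norm)
    finally show ?thesis .
  qed
  ultimately have "weak_contraction f"
    by (simp add: weak_contraction_def)
  then have W: "wIFS W"
    using Q sub by (auto simp: wIFS_def W_def weak_contraction_def)
  have "f q = p" if "q \<in> F" for q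
    using p_max[OF that] by (simp add: f_def flat_step_def)
  moreover have "f (p + flat_orbit \<delta> n *\<^sub>R axis i 1) = p + flat_orbit \<delta> (Suc n) *\<^sub>R axis i 1" for n
    by (simp add: f_def flat_orbit_Suc)
  ultimately have fA: "f ` spike F p i \<delta> = insert p (range (\<lambda>n. p + flat_orbit \<delta> (Suc n) *\<^sub>R axis i 1))"
    using F(3) unfolding spike_def image_Un by (auto simp: image_image)
  have range_Suc: "range g = insert (g 0) (range (\<lambda>n. g (Suc n)))" for g :: "nat \<Rightarrow> real ^ 'n"
    by (subst UNIV_nat_eq) (simp add: image_image)
  have "(\<Union>g\<in>W. g ` spike F p i \<delta>) = Q \<union> f ` spike F p i \<delta>"
    using p by (auto simp: W_def)
  also have "\<dots> = F \<union> (insert (p + flat_orbit \<delta> 0 *\<^sub>R axis i 1)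
      (range (\<lambda>n. p + flat_orbit \<delta> (Suc n) *\<^sub>R axis i 1)))"
    using F(3) by (auto simp: fA Q_def)
  also have "\<dots> = spike F p i \<delta>"
    unfolding spike_def by (simp only: range_Suc[of "\<lambda>n. p + flat_orbit \<delta> n *\<^sub>R axis i 1"])
  finally have "attractor W (spike F p i \<delta>)"
    using spike_in_compacts by (simp add: attractor_def)
  with W show ?thesis
    by (auto simp: wIFS_attractors_def)
qed

text \<open>The \<open>n\<close>-th spike point has distance \<open>flat_orbit \<delta> n\<close>
  from \<open>p\<close>, so the count of orbit terms bounds the count of points from below and
  contradicts the polynomial bound.\<close>

lemma spike_not_in_IFS_attractors: "spike F p i \<delta> \<notin> IFS_attractors"
proof
  let ?A = "spike F p i \<delta>"
  let ?a = "\<lambda>n. p + flat_orbit \<delta> n *\<^sub>R axis i (1 :: real)"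
  assume "?A \<in> IFS_attractors"
  then obtain G where G: "finite G" "\<And>g. g \<in> G \<Longrightarrow> contraction g" "?A = (\<Union>g\<in>G. g ` ?A)"
    by (auto simp: IFS_attractors_def IFS_def attractor_def)
  have p: "p \<in> ?A" and sub: "?A \<subseteq> cube"
    using F spike_in_compacts by (auto simp: spike_def compacts_def)
  have dist_a: "dist (?a n) p = flat_orbit \<delta> n" for n
    using flat_orbit_pos[OF \<delta>(1), of n] by (simp add: dist_norm)
  have fin: "finite {x \<in> ?A. t < dist x p}" if "0 < t" for t
  proof (rule finite_subset)
    show "{x \<in> ?A. t < dist x p} \<subseteq> F \<union> ?a ` {n. t < flat_orbit \<delta> n}"
      using dist_a by (auto simp: spike_def)
    show "finite (F \<union> ?a ` {n. t < flat_orbit \<delta> n})"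
      using F finite_flat_orbit_greater[OF \<delta>(1) that] by simp
  qed
  have lip: "\<exists>L<1. L-lipschitz_on ?A g" if "g \<in> G" for g
    using G(2)[OF that] lipschitz_on_subset[OF _ sub] unfolding contraction_def by blast
  obtain L K D :: real where L: "0 < L" "L < 1" "0 < K"
    and up: "\<And>j. card {x \<in> ?A. L ^ j < dist x p} \<le> D * K ^ j"
    using self_similar_card_bound[OF fin p G(1) lip G(3)] by blast
  obtain j where j: "2 * L ^ j \<le> \<delta>" "D * K ^ j < L ^ j * exp (1 / (2 * L ^ j))"
    using exp_inverse_not_polynomially_bounded[OF L(1,2) \<delta>(1) L(3)] by blast
  have "L ^ j * exp (1 / (2 * L ^ j)) \<le> card {n. L ^ j < flat_orbit \<delta> n}"
    using L j \<delta> by (intro card_flat_orbit_greater) auto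
  also have "card {n. L ^ j < flat_orbit \<delta> n} = card (?a ` {n. L ^ j < flat_orbit \<delta> n})"
    using inj_flat_orbit[OF \<delta>(1)] by (intro card_image[symmetric]) (auto simp: inj_on_def)
  also have "\<dots> \<le> card {x \<in> ?A. L ^ j < dist x p}"
    using fin[of "L ^ j"] L dist_a by (intro card_mono) (auto simp: spike_def)
  finally show False
    using up[of j] j by linarith
qed

end

section \<open>Density in the Hausdorff metric\<close>

text \<open>Discretizing \<open>K\<close>, shrinking the net and attaching the spike each cost at
  most \<open>r / 3\<close>.\<close>

lemma spike_approximation:
  fixes K :: "(real ^ 'n) set"
  assumes K: "K \<in> compacts" and r: "0 < r"
  shows "\<exists>A \<in> wIFS_attractors - IFS_attractors. A \<in> compacts \<and> hausdorff_dist K A \<le> r"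
proof -
  have K': "compact K" "K \<noteq> {}" "K \<subseteq> cube"
    using K by (auto simp: compacts_def)
  have cover: "K \<subseteq> (\<Union>c\<in>K. ball c (r / 3))"
    using r by force
  obtain T where T: "T \<subseteq> K" "finite T" "K \<subseteq> (\<Union>c\<in>T. ball c (r / 3))"
    by (rule compactE_image[OF K'(1) _ cover]) simp_all
  obtain B where B: "0 < B" "\<And>x. x \<in> K \<Longrightarrow> norm x \<le> B"
    using compact_imp_bounded[OF K'(1)] by (auto simp: bounded_pos)
  \<comment> \<open>The second term keeps the displacement \<open>\<eta> * norm x\<close> within
    \<open>r / 3\<close> on \<open>K\<close>.\<close>
  define \<eta> where "\<eta> = min (1 / 2) (r / (3 * B))"
  have \<eta>: "0 < \<eta>" "\<eta> \<le> 1 / 2" "\<eta> * B \<le> r / 3"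
    using r B by (auto simp: \<eta>_def min_def field_simps)
  \<comment> \<open>Shrinking towards the origin makes room in the cube for the spike.\<close>
  define s where "s x = (1 - \<eta>) *\<^sub>R x" for x :: "real ^ 'n"
  have dist_s: "dist x (s x) \<le> r / 3" if "x \<in> K" for x
  proof -
    have "dist x (s x) = \<eta> * norm x"
      using \<eta> by (simp add: dist_norm s_def algebra_simps)
    also have "\<dots> \<le> \<eta> * B"
      using B(2)[OF that] \<eta> by (intro mult_left_mono) auto
    finally show ?thesis
      using \<eta>(3) by simp
  qed
  fix i :: 'n
  define F where "F = s ` T"
  have s_bds: "0 \<le> s x $ j \<and> s x $ j \<le> 1 - \<eta>" if "x \<in> K" for x j
  proof -
    have "0 \<le> x $ j" "x $ j \<le> 1"
      using that K' by (auto simp: cube_def mem_box_cart)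
    then show ?thesis
      using \<eta> by (simp add: s_def mult_left_le)
  qed
  have "T \<noteq> {}"
    using T K' by auto
  then have F: "finite F" "F \<noteq> {}"
    using T by (auto simp: F_def)
  have F_bds: "0 \<le> x $ j \<and> x $ j \<le> 1 - \<eta>" if "x \<in> F" for x j
    using that s_bds T by (auto simp: F_def)
  have "0 \<le> x $ j \<and> x $ j \<le> 1" if "x \<in> F" for x j
    using F_bds[OF that, of j] \<eta>(1) by linarith
  then have "F \<subseteq> cube"
    by (auto simp: cube_def mem_box_cart)
  obtain p where p: "p \<in> F" "\<And>x. x \<in> F \<Longrightarrow> x $ i \<le> p $ i"
    using arg_min_if_finite[OF F, of "\<lambda>x. - (x $ i)"] by (metis neg_less_iff_less not_le)
  \<comment> \<open>The bound \<open>\<eta>\<close> keeps the tip of the spike in the cube, since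
    coordinates of points of \<open>F\<close> are at most \<open>1 - \<eta>\<close>.\<close>
  define \<delta> where "\<delta> = min (r / 3) \<eta>"
  have \<delta>: "0 < \<delta>" "\<delta> \<le> r / 3" "p $ i + \<delta> \<le> 1"
    using r \<eta> F_bds[OF p(1), of i] by (auto simp: \<delta>_def)
  note hyps = F(1) \<open>F \<subseteq> cube\<close> p \<delta>(1,3)
  let ?A = "spike F p i \<delta>"
  have A: "?A \<in> compacts" "?A \<in> wIFS_attractors - IFS_attractors"
    using spike_in_compacts[OF hyps] spike_in_wIFS_attractors[OF hyps]
      spike_not_in_IFS_attractors[OF hyps] by auto
  have "\<exists>a\<in>?A. dist x a \<le> r" if x: "x \<in> K" for x
  proof -
    obtain c where c: "c \<in> T" "dist x c < r / 3"
      using T(3) x by (auto simp: dist_commute)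
    have "dist x (s c) \<le> r"
      using dist_triangle[of x "s c" c] dist_s[of c] c T r by auto
    then show ?thesis
      using c by (auto simp: spike_def F_def)
  qed
  moreover have near_F: "\<exists>x\<in>K. dist a x \<le> r / 3" if "a \<in> F" for a
    using that dist_s T by (auto simp: F_def dist_commute)
  have "\<exists>x\<in>K. dist a x \<le> r" if a: "a \<in> ?A" for a
  proof -
    have "\<exists>b\<in>F. dist a b \<le> r / 3"
    proof (cases "a \<in> F")
      case True
      then show ?thesis
        using r by (intro bexI[of _ a]) auto
    next
      case False
      then obtain n where "a = p + flat_orbit \<delta> n *\<^sub>R axis i 1"
        using a by (auto simp: spike_def)
      then have "dist a p = flat_orbit \<delta> n"
        using flat_orbit_pos[OF \<delta>(1), of n] by (simp add: dist_norm)
      also have "\<dots> \<le> r / 3"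
        using flat_orbit_le[OF \<delta>(1), of n] \<delta>(2) by linarith
      finally show ?thesis
        using p(1) by blast
    qed
    then obtain b x where "b \<in> F" "x \<in> K" "dist a b \<le> r / 3" "dist b x \<le> r / 3"
      using near_F by blast
    then show ?thesis
      using dist_triangle[of a x b] r by (intro bexI[of _ x]) auto
  qed
  ultimately show ?thesis
    using A hausdorff_dist_le_iff[OF K A(1)] by blast
qed

theorem proposition3p2:
  shows "Metric_space.mtopology compacts hausdorff_dist closure_of
           (wIFS_attractors - IFS_attractors) = (compacts :: (real ^ 'n) set set)"
proof -
  interpret Metric_space "compacts :: (real ^ 'n) set set" hausdorff_dist
    by (rule Metric_space_hausdorff_dist)
  show ?thesis
    \<comment> \<open>This form of the closure uses closed balls, matching the non-strict bound in
      \<open>spike_approximation\<close>.\<close>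
    unfolding metric_closure_of_alt using spike_approximation
    by fastforce
qed

end
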